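(* (Cole-Cole model.) Let $\rho>0$, $G_\infty>0$, $\tau>0$, $a>1$, $0<\alpha<1$, $c_0=(G_\infty/\rho)^{1/2}$, and let $$\kappa(p)=\frac{p}{c_0}\left[\frac{1+(\tau p)^\alpha}{1+a(\tau p)^\alpha}\right]^{1/2},\qquad p\in\mathbb{C}\setminus(-\infty,0].$$ For $r>0$ put $\mathcal J_1=-(a-1)\sin(\pi\alpha)(\tau r)^\alpha$, $\mathcal R_1=1+a(\tau r)^{2\alpha}+(a+1)\cos(\pi\alpha)(\tau r)^\alpha$, $Z=\sqrt{1+a^2(\tau r)^{2\alpha}+2a\cos(\pi\alpha)(\tau r)^\alpha}$ and $$h(r)=\frac{1}{\pi c_0\sqrt2}\,\frac{\sqrt{\sqrt{\mathcal R_1^2+\mathcal J_1^2}-\mathcal R_1}}{Z}.$$ Then $$\kappa(p)=\frac{a^{-1/2}}{c_0}\,p+p\int_0^\infty\frac{h(r)\,dr}{p+r}\qquad (p\in\mathbb{C}\setminus(-\infty,0]),$$ and consequently the attenuation and dispersion functions of the Cole-Cole model are, for real $\omega\ne0$, $$\mathcal A(\omega)=\omega^2\int_0^\infty\frac{h(r)}{r^2+\omega^2}\,dr,\qquad \mathcal D(\omega)=\omega\int_0^\infty\frac{r\,h(r)}{r^2+\omega^2}\,dr .$$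
   Context: Powers and square roots are principal branches (positive for $p>0$). The Cole-Cole model is the viscoelastic model whose relaxation modulus $G$ has Laplace transform $\tilde G(p)=\frac{G_\infty}{p}\,\frac{1+a(\tau p)^\alpha}{1+(\tau p)^\alpha}$; its complex wave number function is $\kappa(p)=\rho^{1/2}p/Q(p)^{1/2}$ with $Q(p)=p\tilde G(p)$, which gives the displayed $\kappa$. Writing $\kappa(p)=Bp+\beta(p)$ with $B=\lim_{p\to+\infty}\kappa(p)/p$, the attenuation function is $\mathcal A(\omega)=\operatorname{Re}\beta(-i\omega)$ and the dispersion function is $\mathcal D(\omega)=-\operatorname{Im}\beta(-i\omega)$. *)

theory Defs
  imports "HOL-Analysis.Analysis"
begin

text \<open>
  A viscoelastic medium enters through the Laplace transform of its relaxation modulus, continued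
  to the plane cut along the non-positive real axis. Complex powers and square roots are the
  principal branches \<^const>\<open>powr\<close> and \<^const>\<open>csqrt\<close>.
\<close>

definition wave_number :: "real \<Rightarrow> (complex \<Rightarrow> complex) \<Rightarrow> complex \<Rightarrow> complex"
  where "wave_number \<rho> Gt p = of_real (sqrt \<rho>) * p / csqrt (p * Gt p)"

definition wavefront_slope :: "(complex \<Rightarrow> complex) \<Rightarrow> complex"
  where "wavefront_slope \<kappa> = Lim at_top (\<lambda>x::real. \<kappa> (of_real x) / of_real x)"

definition wave_number_remainder :: "(complex \<Rightarrow> complex) \<Rightarrow> complex \<Rightarrow> complex"
  where "wave_number_remainder \<kappa> p = \<kappa> p - wavefront_slope \<kappa> * p"

definition attenuation :: "(complex \<Rightarrow> complex) \<Rightarrow> real \<Rightarrow> real"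
  where "attenuation \<kappa> \<omega> = Re (wave_number_remainder \<kappa> (- \<i> * of_real \<omega>))"

definition dispersion :: "(complex \<Rightarrow> complex) \<Rightarrow> real \<Rightarrow> real"
  where "dispersion \<kappa> \<omega> = - Im (wave_number_remainder \<kappa> (- \<i> * of_real \<omega>))"

definition cole_cole_transform :: "real \<Rightarrow> real \<Rightarrow> real \<Rightarrow> real \<Rightarrow> complex \<Rightarrow> complex"
  where "cole_cole_transform Ginf \<tau> a \<alpha> p =
    of_real Ginf / p *
      ((1 + of_real a * (of_real \<tau> * p) powr of_real \<alpha>) / (1 + (of_real \<tau> * p) powr of_real \<alpha>))"

definition cole_cole_kappa :: "real \<Rightarrow> real \<Rightarrow> real \<Rightarrow> real \<Rightarrow> complex \<Rightarrow> complex"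
  where "cole_cole_kappa c\<^sub>0 \<tau> a \<alpha> p =
    p / of_real c\<^sub>0 *
      csqrt ((1 + (of_real \<tau> * p) powr of_real \<alpha>) / (1 + of_real a * (of_real \<tau> * p) powr of_real \<alpha>))"

definition cole_cole_J :: "real \<Rightarrow> real \<Rightarrow> real \<Rightarrow> real \<Rightarrow> real"
  where "cole_cole_J \<tau> a \<alpha> r = - (a - 1) * sin (pi * \<alpha>) * (\<tau> * r) powr \<alpha>"

definition cole_cole_R :: "real \<Rightarrow> real \<Rightarrow> real \<Rightarrow> real \<Rightarrow> real"
  where "cole_cole_R \<tau> a \<alpha> r =
    1 + a * (\<tau> * r) powr (2 * \<alpha>) + (a + 1) * cos (pi * \<alpha>) * (\<tau> * r) powr \<alpha>"

definition cole_cole_Z :: "real \<Rightarrow> real \<Rightarrow> real \<Rightarrow> real \<Rightarrow> real"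
  where "cole_cole_Z \<tau> a \<alpha> r =
    sqrt (1 + a\<^sup>2 * (\<tau> * r) powr (2 * \<alpha>) + 2 * a * cos (pi * \<alpha>) * (\<tau> * r) powr \<alpha>)"

definition cole_cole_h :: "real \<Rightarrow> real \<Rightarrow> real \<Rightarrow> real \<Rightarrow> real \<Rightarrow> real"
  where "cole_cole_h c\<^sub>0 \<tau> a \<alpha> r =
    1 / (pi * c\<^sub>0 * sqrt 2) *
      (sqrt (sqrt ((cole_cole_R \<tau> a \<alpha> r)\<^sup>2 + (cole_cole_J \<tau> a \<alpha> r)\<^sup>2) - cole_cole_R \<tau> a \<alpha> r)
        / cole_cole_Z \<tau> a \<alpha> r)"

end

theory Submission
  imports Defs "HOL-Complex_Analysis.Complex_Analysis"
begin

text \<open>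
  In the coordinate \<open>z = Ln p\<close> the cut plane becomes the strip \<open>\<bar>Im z\<bar> < pi\<close>, and the bracket
  \<open>csqrt ((1 + w) / (1 + a w))\<close> with \<open>w = (\<tau> p) powr \<alpha> = \<tau> powr \<alpha> * exp (\<alpha> z)\<close> is holomorphic on the
  wider strip \<open>\<bar>Im z\<bar> < pi / \<alpha>\<close>, so both sides of the cut are interior lines. Subtracting the value
  \<open>a powr (-1/2)\<close> at infinity gives a function \<open>G\<close> that tends to \<open>0\<close> on the right and is bounded on
  the left. The residue theorem for \<open>G z * exp z / (exp z - p)\<close> on the rectangles with
  \<open>\<bar>Re z\<bar> \<le> n\<close>, \<open>\<bar>Im z\<bar> \<le> pi\<close> yields, after \<open>r = exp x\<close>, the Stieltjes representation of \<open>G\<close>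
  with density \<open>- Im G (ln r + i pi) / pi\<close>, which is \<open>c\<^sub>0 h r\<close>. The attenuation and dispersion formulas
  are its real and imaginary parts at \<open>p = - i \<omega>\<close>.
\<close>

section \<open>Stieltjes representation of functions on a strip\<close>

text \<open>The substitution \<open>r = exp x\<close> turns \<open>dx\<close> into
  \<open>dr / r\<close>. On a compact range \<open>r\<close> stays away from 0, so
  \<open>ln r\<close> and \<open>1 / r\<close> are continuous there.\<close>

lemma contour_integral_horizontal_ln:
  fixes f :: "complex \<Rightarrow> complex"
  assumes "a < b" and cont: "continuous_on (closed_segment (Complex a c) (Complex b c)) f"
  shows "contour_integral (linepath (Complex a c) (Complex b c)) f =
    integral {exp a..exp b} (\<lambda>r. f (Complex (ln r) c) / of_real r)"
proof -
  let ?g = "\<lambda>t. exp (a + (b - a) * t)"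
  let ?\<psi> = "\<lambda>r. f (Complex (ln r) c) / of_real r"
  have seg: "Complex x c \<in> closed_segment (Complex a c) (Complex b c)" if "a \<le> x" "x \<le> b" for x
    using that assms(1) by (simp add: closed_segment_same_Im closed_segment_eq_real_ivl)
  have "continuous_on {exp a..exp b} (\<lambda>r. Complex (ln r) c)"
    unfolding Complex_eq by (intro continuous_intros) (auto intro: less_le_trans[of 0 "exp a"])
  then have "continuous_on {exp a..exp b} (\<lambda>r. f (Complex (ln r) c))"
  proof (rule continuous_on_compose2[OF cont])
    show "(\<lambda>r. Complex (ln r) c) ` {exp a..exp b} \<subseteq> closed_segment (Complex a c) (Complex b c)"
    proof safe
      fix r assume r: "r \<in> {exp a..exp b}"
      then have "r > 0" by (auto intro: less_le_trans[of 0 "exp a"])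
      with r show "Complex (ln r) c \<in> closed_segment (Complex a c) (Complex b c)"
        by (intro seg) (auto simp: ln_ge_iff ln_le_cancel_iff[of r "exp b", simplified])
    qed
  qed
  then have cont_psi: "continuous_on {exp a..exp b} ?\<psi>"
    by (intro continuous_intros) (auto intro: less_le_trans[of 0 "exp a"])
  have "((\<lambda>t. ((b - a) * ?g t) *\<^sub>R ?\<psi> (?g t)) has_integral (integral {?g 0..?g 1} ?\<psi>)) {0..1}"
  proof (rule has_integral_substitution)
    have "?g t \<in> {exp a..exp b}" if t: "t \<in> {0..1}" for t
    proof -
      from t have "(b - a) * t \<le> b - a" "0 \<le> (b - a) * t"
        using assms(1) by (auto intro: mult_left_le)
      then have "a \<le> a + (b - a) * t" "a + (b - a) * t \<le> b" by linarith+
      then show "?g t \<in> {exp a..exp b}"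
        unfolding atLeastAtMost_iff exp_le_cancel_iff by blast
    qed
    then show "?g ` {0..1} \<subseteq> {exp a..exp b}" by blast
  qed (use assms(1) cont_psi in \<open>auto intro!: derivative_eq_intros\<close>)
  also have "(\<lambda>t. ((b - a) * ?g t) *\<^sub>R ?\<psi> (?g t)) =
     (\<lambda>t. f (linepath (Complex a c) (Complex b c) t) * (Complex b c - Complex a c))"
  proof
    fix t
    have "linepath (Complex a c) (Complex b c) t = Complex (a + (b - a) * t) c"
      by (auto simp: linepath_def complex_eq_iff algebra_simps)
    moreover have "Complex b c - Complex a c = of_real (b - a)" by (simp add: complex_eq_iff)
    ultimately show "((b - a) * ?g t) *\<^sub>R ?\<psi> (?g t) =
       f (linepath (Complex a c) (Complex b c) t) * (Complex b c - Complex a c)"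
      by (simp add: scaleR_conv_of_real)
  qed
  finally have "(f has_contour_integral integral {?g 0..?g 1} ?\<psi>) (linepath (Complex a c) (Complex b c))"
    by (simp add: has_contour_integral_linepath)
  then show ?thesis by (simp add: contour_integral_unique)
qed

text \<open>Convergence along \<open>filtercomap Re F\<close> is uniform in the imaginary part, and
  the segments have constant length, so the bound by maximum times length suffices. Leaving
  \<open>F\<close> general covers the right side (\<open>at_top\<close>) and the left side
  (\<open>at_bot\<close>) together.\<close>

lemma contour_integral_vertical_tendsto_0:
  fixes f :: "complex \<Rightarrow> complex"
  assumes f: "(f \<longlongrightarrow> 0) (filtercomap Re F)" and X: "filterlim X F sequentially"
    and int: "\<forall>\<^sub>F n in sequentially. f contour_integrable_on linepath (Complex (X n) u) (Complex (X n) v)"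
  shows "(\<lambda>n::nat. contour_integral (linepath (Complex (X n) u) (Complex (X n) v)) f) \<longlonglongrightarrow> 0"
proof (rule tendstoI)
  fix e :: real assume e: "e > 0"
  \<comment> \<open>The \<open>+ 1\<close> keeps the denominator positive when \<open>u = v\<close>
    and makes the final estimate strict.\<close>
  define \<delta> where "\<delta> = e / (\<bar>v - u\<bar> + 1)"
  have \<delta>: "\<delta> > 0" using e by (simp add: \<delta>_def)
  have "\<forall>\<^sub>F z in filtercomap Re F. norm (f z) < \<delta>"
    using tendstoD[OF f \<delta>] by simp
  then obtain Q where Q: "eventually Q F" "\<And>z. Q (Re z) \<Longrightarrow> norm (f z) < \<delta>"
    by (auto simp: eventually_filtercomap)
  have "\<forall>\<^sub>F n in sequentially. Q (X n)" using Q(1) X by (rule eventually_compose_filterlim)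
  with int show "\<forall>\<^sub>F n in sequentially. dist (contour_integral (linepath (Complex (X n) u) (Complex (X n) v)) f) 0 < e"
  proof eventually_elim
    case (elim n)
    have "norm (contour_integral (linepath (Complex (X n) u) (Complex (X n) v)) f)
        \<le> \<delta> * norm (Complex (X n) v - Complex (X n) u)"
    proof (rule contour_integral_bound_linepath)
      fix x assume "x \<in> closed_segment (Complex (X n) u) (Complex (X n) v)"
      then have "Re x = X n" by (simp add: closed_segment_same_Re)
      then show "norm (f x) \<le> \<delta>" using Q(2)[of x] elim(2) by simp
    qed (use elim \<delta> in auto)
    also have "Complex (X n) v - Complex (X n) u = \<i> * of_real (v - u)"
      by (simp add: complex_eq_iff)
    also have "\<delta> * norm (\<i> * complex_of_real (v - u)) = \<delta> * \<bar>v - u\<bar>"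
      by (simp only: norm_mult norm_ii norm_of_real)
    also have "\<dots> < e" using e by (simp add: \<delta>_def field_simps)
    finally show ?case by simp
  qed
qed

lemma not_nonpos_add_of_real_ne_0:
  assumes "p \<notin> \<real>\<^sub>\<le>\<^sub>0" "r \<ge> 0"
  shows "p + complex_of_real r \<noteq> 0"
proof
  assume "p + complex_of_real r = 0"
  then have "p = of_real (- r)" by (simp add: eq_neg_iff_add_eq_0)
  with assms show False by (simp add: complex_nonpos_Reals_iff)
qed

text \<open>The kernel \<open>exp z / (exp z - p)\<close> has residue 1 at \<open>Ln p\<close> and
  equals \<open>r / (p + r)\<close> on both lines \<open>Im z = pi\<close> and
  \<open>Im z = - pi\<close>. It tends to 1 on the right and to 0 on the left; hence
  \<open>G\<close> must vanish on the right, while on the left a finite limit is enough.\<close>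

lemma rectangle_residue_limit:
  fixes G :: "complex \<Rightarrow> complex"
  assumes d: "d > pi" and holo: "G holomorphic_on {z. \<bar>Im z\<bar> < d}"
    and top: "(G \<longlongrightarrow> 0) (filtercomap Re at_top)" and bot: "(G \<longlongrightarrow> L) (filtercomap Re at_bot)"
    and p: "p \<notin> \<real>\<^sub>\<le>\<^sub>0"
  shows "(\<lambda>n. integral {exp (- real n)..exp (real n)} (\<lambda>r. G (Complex (ln r) (- pi)) / (p + of_real r))
            - integral {exp (- real n)..exp (real n)} (\<lambda>r. G (Complex (ln r) pi) / (p + of_real r)))
          \<longlonglongrightarrow> 2 * pi * \<i> * G (Ln p)"
proof -
  have p0: "p \<noteq> 0" using p by auto
  define z0 where "z0 = Ln p"
  have z0: "exp z0 = p" using p0 by (simp add: z0_def)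
  have Imz0: "\<bar>Im z0\<bar> < pi"
    using p mpi_less_Im_Ln[OF p0] Im_Ln_less_pi[OF p] by (simp add: z0_def abs_less_iff)
  define d' where "d' = min d (2 * pi - \<bar>Im z0\<bar>)"
  have d': "d' > pi" "d' \<le> d" using d Imz0 by (auto simp: d'_def)
  define S where "S = {z. \<bar>Im z\<bar> < d'}"
  define f where "f = (\<lambda>z. G z * (exp z / (exp z - p)))"
  \<comment> \<open>The bound d' is chosen so that Ln p is the only logarithm of p in the strip S.\<close>
  have exp_p: "exp z = p \<longleftrightarrow> z = z0" if "z \<in> S" for z
  proof
    assume "exp z = p"
    then have "exp z = exp z0" using z0 by simp
    moreover have "\<bar>Im z - Im z0\<bar> < 2 * pi"
      using that by (auto simp: S_def d'_def)
    ultimately show "z = z0" by (auto intro: exp_complex_eqI)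
  qed (use z0 in simp)
  have S: "open S" "convex S"
  proof -
    have "S = Im -` {-d'<..<d'}" by (auto simp: S_def)
    then show "open S" by (auto intro!: open_vimage continuous_intros)
    have "S = {z. Im z < d'} \<inter> {z. Im z > - d'}" by (auto simp: S_def)
    then show "convex S" by (auto intro!: convex_Int convex_halfspace_Im_lt convex_halfspace_Im_gt)
  qed
  have z0S: "z0 \<in> S" using Imz0 d' by (simp add: S_def)
  have G_S: "G holomorphic_on S"
    using holo by (rule holomorphic_on_subset) (use d' in \<open>auto simp: S_def\<close>)
  have f_holo: "f holomorphic_on S - {z0}"
    unfolding f_def by (intro holomorphic_intros holomorphic_on_subset[OF G_S]) (auto simp: exp_p)
  have f_res: "residue f z0 = G z0"
  proof (rule residue_simple'[OF S(1) z0S f_holo])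
    \<comment> \<open>The factor \<open>w - z0\<close> is absorbed into the difference quotient of
      \<open>exp\<close>, whose limit \<open>exp z0 = p\<close> is nonzero and cancels the
      numerator.\<close>
    have "((\<lambda>w. (exp w - exp z0) / (w - z0)) \<longlongrightarrow> exp z0) (at z0)"
      using DERIV_exp[of z0] by (simp add: has_field_derivative_iff)
    moreover have "(G \<longlongrightarrow> G z0) (at z0)"
      using G_S S(1) z0S by (metis continuous_on_eq_continuous_at holomorphic_on_imp_continuous_on isContD)
    ultimately have "((\<lambda>w. G w * (exp w / ((exp w - exp z0) / (w - z0)))) \<longlongrightarrow> G z0 * (exp z0 / exp z0)) (at z0)"
      by (intro tendsto_intros) auto
    then show "((\<lambda>w. f w * (w - z0)) \<longlongrightarrow> G z0) (at z0)"
      using p0 by (simp add: f_def z0 mult.assoc)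
  qed
  have lim_top: "(f \<longlongrightarrow> 0) (filtercomap Re at_top)"
  proof -
    have exp_inf: "filterlim (exp :: complex \<Rightarrow> complex) at_infinity (filtercomap Re at_top)"
      by (rule filterlim_norm_at_top_imp_at_infinity)
         (auto simp: norm_exp_eq_Re intro!: filterlim_compose[OF exp_at_top] filterlim_filtercomap)
    have inv: "((\<lambda>z. inverse (exp z)) \<longlongrightarrow> 0) (filtercomap Re at_top)"
      by (rule filterlim_compose[OF tendsto_inverse_0 exp_inf])
    have "((\<lambda>z. G z * (1 / (1 - p * inverse (exp z)))) \<longlongrightarrow> 0 * (1 / (1 - p * 0))) (filtercomap Re at_top)"
      by (intro tendsto_intros top inv) auto
    \<comment> \<open>This holds at every \<open>z\<close>: where \<open>exp z = p\<close>, both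
      sides are 0 by the convention for division by zero.\<close>
    moreover have "f = (\<lambda>z. G z * (1 / (1 - p * inverse (exp z))))"
      unfolding f_def by (intro ext) (simp add: field_simps)
    ultimately show ?thesis by simp
  qed
  have lim_bot: "(f \<longlongrightarrow> 0) (filtercomap Re at_bot)"
  proof -
    have exp_0: "((exp :: complex \<Rightarrow> complex) \<longlongrightarrow> 0) (filtercomap Re at_bot)"
      by (rule tendsto_norm_zero_cancel)
         (auto simp: norm_exp_eq_Re intro!: filterlim_compose[OF exp_at_bot] filterlim_filtercomap)
    have "(f \<longlongrightarrow> L * (0 / (0 - p))) (filtercomap Re at_bot)"
      unfolding f_def by (intro tendsto_intros bot exp_0) (use p0 in auto)
    then show ?thesis by simp
  qed
  define V where "V = (\<lambda>x. linepath (Complex x (-pi)) (Complex x pi))"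
  define I where "I = (\<lambda>n s. integral {exp (- real n)..exp (real n)} (\<lambda>r. G (Complex (ln r) s) / (p + of_real r)))"
  \<comment> \<open>From this \<open>n\<close> on, the pole lies strictly inside the rectangle and
    no side meets it.\<close>
  have ev: "\<forall>\<^sub>F n in sequentially. real n > \<bar>Re z0\<bar>"
    using filterlim_real_sequentially by (auto simp: filterlim_at_top_dense)
  have f_cont: "continuous_on (closed_segment u v) f"
    if "closed_segment u v \<subseteq> S - {z0}" for u v
    using f_holo that holomorphic_on_imp_continuous_on continuous_on_subset by blast
  have hor: "closed_segment (Complex (- x) s) (Complex x s) \<subseteq> S - {z0}" if "\<bar>s\<bar> = pi" for x s
    using that d' Imz0 by (auto simp: S_def closed_segment_same_Im)
  have ver: "closed_segment (Complex x (-pi)) (Complex x pi) \<subseteq> S - {z0}" if "\<bar>x\<bar> > \<bar>Re z0\<bar>" for x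
    using that d' Imz0 by (auto simp: S_def closed_segment_same_Re closed_segment_eq_real_ivl)
  have int_hor: "contour_integral (linepath (Complex (- real n) s) (Complex (real n) s)) f = I n s"
    if s: "\<bar>s\<bar> = pi" and n: "real n > \<bar>Re z0\<bar>" for n s
  proof -
    have "contour_integral (linepath (Complex (- real n) s) (Complex (real n) s)) f =
       integral {exp (- real n)..exp (real n)} (\<lambda>r. f (Complex (ln r) s) / of_real r)"
      by (rule contour_integral_horizontal_ln) (use n f_cont[OF hor[OF s]] in auto)
    also have "\<dots> = I n s"
      unfolding I_def
    proof (rule integral_cong)
      fix r assume "r \<in> {exp (- real n)..exp (real n)}"
      then have r: "r > 0" by (auto intro: less_le_trans[of 0 "exp (- real n)"])
      have "s = pi \<or> s = - pi" using s by linarith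
      \<comment> \<open>Both horizontal lines are mapped by \<open>exp\<close> to the negative axis,
        so \<open>exp z = - r\<close>; the factor \<open>1 / r\<close> from the substitution then
        cancels the numerator of the kernel.\<close>
      then have "cis s = -1" by (auto simp: complex_eq_iff)
      then have e: "exp (Complex (ln r) s) = - of_real r"
        using r by (simp add: exp_eq_polar)
      have "p + of_real r \<noteq> 0" 
        using p r by (simp add: not_nonpos_add_of_real_ne_0)
      then show "f (Complex (ln r) s) / of_real r = G (Complex (ln r) s) / (p + of_real r)"
        unfolding f_def e using r
        by (simp add: divide_simps) (auto simp: eq_neg_iff_add_eq_0 algebra_simps)
    qed
    finally show ?thesis .
  qed
  have V_int: "f contour_integrable_on V x" if "\<bar>x\<bar> > \<bar>Re z0\<bar>" for x
    unfolding V_def by (intro contour_integrable_continuous_linepath f_cont ver that)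
  have "(\<lambda>n. contour_integral (V (real n)) f) \<longlonglongrightarrow> 0"
    unfolding V_def
    by (rule contour_integral_vertical_tendsto_0[OF lim_top filterlim_real_sequentially])
       (use V_int in \<open>auto simp: V_def intro!: eventually_mono[OF ev]\<close>)
  moreover have "(\<lambda>n. contour_integral (V (- real n)) f) \<longlonglongrightarrow> 0"
    unfolding V_def
    by (rule contour_integral_vertical_tendsto_0[OF lim_bot
          filterlim_compose[OF filterlim_uminus_at_bot_at_top filterlim_real_sequentially]])
       (use V_int in \<open>auto simp: V_def intro!: eventually_mono[OF ev]\<close>)
  \<comment> \<open>This is the residue identity solved for the horizontal sides. The right side is
    traversed upwards and the left side downwards, hence the opposite signs.\<close>
  ultimately have "(\<lambda>n. 2 * pi * \<i> * G z0 - contour_integral (V (real n)) f + contour_integral (V (- real n)) f)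
     \<longlonglongrightarrow> 2 * pi * \<i> * G z0 - 0 + 0"
    by (intro tendsto_intros)
  moreover have "\<forall>\<^sub>F n in sequentially. 2 * pi * \<i> * G z0 - contour_integral (V (real n)) f + contour_integral (V (- real n)) f
     = I n (-pi) - I n pi"
    using ev
  proof eventually_elim
    case (elim n)
    define R where "R = rectpath (Complex (- real n) (-pi)) (Complex (real n) pi)"
    have "n > 0" using elim by (cases n) auto
    have box: "z0 \<in> box (Complex (- real n) (-pi)) (Complex (real n) pi)"
      using elim Imz0 by (auto simp: in_box_complex_iff)
    have sub: "cbox (Complex (- real n) (-pi)) (Complex (real n) pi) \<subseteq> S"
      using d' by (auto simp: in_cbox_complex_iff S_def)
    have "contour_integral R f = 2 * pi * \<i> * (\<Sum>q\<in>{z0}. winding_number R q * residue f q)"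
    proof (rule Residue_theorem)
      show "path_image R \<subseteq> S - {z0}"
        using sub box by (auto simp: R_def path_image_rectpath_cbox_minus_box)
      show "\<forall>z. z \<notin> S \<longrightarrow> winding_number R z = 0"
        using sub by (auto simp: R_def intro!: winding_number_rectpath_outside)
    qed (use S f_holo convex_connected in \<open>auto simp: R_def\<close>)
    moreover have "winding_number R z0 = 1"
      unfolding R_def by (rule winding_number_rectpath[OF box])
    ultimately have 1: "contour_integral R f = 2 * pi * \<i> * G z0" by (simp add: f_res)
    have intg: "f contour_integrable_on (linepath (Complex (- real n) (- pi)) (Complex (real n) (- pi)))"
       "f contour_integrable_on (linepath (Complex (real n) (- pi)) (Complex (real n) pi))"
       "f contour_integrable_on (linepath (Complex (real n) pi) (Complex (- real n) pi))"
       "f contour_integrable_on (linepath (Complex (- real n) pi) (Complex (- real n) (- pi)))"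
      using hor[of "-pi" "real n"] hor[of pi "real n"] ver[of "real n"] ver[of "- real n"] elim
      by (auto intro!: contour_integrable_continuous_linepath f_cont simp: closed_segment_commute)
    have "contour_integral R f = contour_integral (linepath (Complex (- real n) (- pi)) (Complex (real n) (- pi))) f
       + (contour_integral (V (real n)) f + (contour_integral (linepath (Complex (real n) pi) (Complex (- real n) pi)) f
       + contour_integral (linepath (Complex (- real n) pi) (Complex (- real n) (- pi))) f))"
      unfolding R_def rectpath_def Let_def V_def using intg by (simp add: contour_integral_join contour_integrable_join)
    \<comment> \<open>The rectangle is traversed counterclockwise, so its top and left sides are the
      reversals of the segments in \<open>I n pi\<close> and \<open>V (- real n)\<close>.\<close>
    also have "\<dots> = I n (-pi) + contour_integral (V (real n)) f - I n pi - contour_integral (V (- real n)) f"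
      using int_hor[of "-pi" n] int_hor[of pi n] elim contour_integral_reverse_linepath[of "Complex (real n) pi" "Complex (- real n) pi" f]
        contour_integral_reverse_linepath[of "Complex (- real n) pi" "Complex (- real n) (- pi)" f] 
        hor[of pi "real n"] ver[of "- real n"] f_cont
      by (simp add: V_def closed_segment_commute)
    finally show ?case using 1 by (simp add: algebra_simps)
  qed
  ultimately have "(\<lambda>n. I n (-pi) - I n pi) \<longlonglongrightarrow> 2 * pi * \<i> * G z0"
    using Lim_transform_eventually by fastforce
  then show ?thesis by (simp add: I_def z0_def)
qed

section \<open>From truncated integrals to the half-line\<close>

text \<open>The point \<open>p\<close> has positive distance from the cut, so
  \<open>cmod (p + r)\<close> is bounded below by some \<open>e\<close> and the constant
  \<open>cmod (1 - p)\<close> in the triangle inequality is at most a multiple of it. This reduces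
  integrability for every \<open>p\<close> to the case \<open>p = 1\<close>.\<close>

lemma inverse_norm_add_of_real_le:
  assumes p: "p \<notin> \<real>\<^sub>\<le>\<^sub>0"
  obtains C where "C > 0" "\<And>r. r \<ge> 0 \<Longrightarrow> 1 / cmod (p + of_real r) \<le> C / (1 + r)"
proof -
  have "open (- \<real>\<^sub>\<le>\<^sub>0 :: complex set)" by (simp add: open_Compl)
  then obtain e where e: "e > 0" "ball p e \<subseteq> - \<real>\<^sub>\<le>\<^sub>0"
    using p by (meson ComplI open_contains_ball)
  have far: "cmod (p + of_real r) \<ge> e" if "r \<ge> 0" for r
  proof -
    have "of_real (- r) \<notin> ball p e" using e(2) that by (force simp: complex_nonpos_Reals_iff)
    then show ?thesis by (simp add: dist_norm)
  qed
  show ?thesis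
  proof (rule that[of "1 + cmod (1 - p) / e"])
    fix r :: real assume r: "r \<ge> 0"
    have pos: "cmod (p + of_real r) > 0" using far[OF r] e(1) by linarith
    have "1 + r = cmod ((p + of_real r) + (1 - p))"
      using r by (simp add: norm_of_real[of "1 + r", simplified])
    also have "\<dots> \<le> cmod (p + of_real r) + cmod (1 - p)" by (rule norm_triangle_ineq)
    also have "\<dots> \<le> cmod (p + of_real r) + cmod (1 - p) * (cmod (p + of_real r) / e)"
      using mult_left_mono[of 1 "cmod (p + of_real r) / e" "cmod (1 - p)"] far[OF r] e(1) by simp
    finally show "1 / cmod (p + of_real r) \<le> (1 + cmod (1 - p) / e) / (1 + r)"
      using pos r by (simp add: field_simps)
  qed (use e(1) in \<open>simp add: add_pos_nonneg\<close>)
qed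

text \<open>Reflection symmetry turns the jump of \<open>G\<close> between the two sides of the cut
  into \<open>2 * pi * \<i> * H r\<close>, so the residue limit gives the limit of the integrals
  over \<open>[exp (-n), exp n]\<close>. The sign of \<open>H\<close> supplies the absolute
  integrability that allows passing to the whole half-line.\<close>

lemma stieltjes_representation:
  fixes G :: "complex \<Rightarrow> complex" and H :: "real \<Rightarrow> real"
  assumes d: "d > pi" and holo: "G holomorphic_on {z. \<bar>Im z\<bar> < d}"
    and top: "(G \<longlongrightarrow> 0) (filtercomap Re at_top)" and bot: "(G \<longlongrightarrow> L) (filtercomap Re at_bot)"
    and sym: "\<And>z. \<bar>Im z\<bar> < d \<Longrightarrow> G (cnj z) = cnj (G z)"
    and H: "\<And>r. r > 0 \<Longrightarrow> H r = - Im (G (Complex (ln r) pi)) / pi"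
    and nonneg: "\<And>r. r > 0 \<Longrightarrow> H r \<ge> 0"
    and p: "p \<notin> \<real>\<^sub>\<le>\<^sub>0"
  shows "set_integrable lborel {0<..} (\<lambda>r. of_real (H r) / (p + of_real r))"
    and "(LBINT r:{0<..}. of_real (H r) / (p + of_real r)) = G (Ln p)"
proof -
  define A where "A = (\<lambda>n. {exp (- real n)..exp (real n)})"
  have A_pos: "r > 0" if "r \<in> A n" for r n
    using that by (auto simp: A_def intro: less_le_trans[of 0 "exp (- real n)"])
  have A_mono: "mono A" by (auto simp: A_def mono_def intro: order_trans)
  have A_UN: "(\<Union>n. A n) = {0<..}"
  proof (intro equalityI subsetI)
    fix r :: real assume "r \<in> {0<..}"
    moreover obtain n where "\<bar>ln r\<bar> < real n" using reals_Archimedean2 by blast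
    ultimately have "r \<in> A n" by (auto simp: A_def ln_ge_iff[symmetric] ln_le_cancel_iff[of r "exp (real n)", simplified, symmetric])
    then show "r \<in> (\<Union>n. A n)" by blast
  qed (use A_pos in auto)
  have cont_G: "continuous_on {0<..} (\<lambda>r. G (Complex (ln r) s))" if "\<bar>s\<bar> = pi" for s
  proof (rule continuous_on_compose2[OF holomorphic_on_imp_continuous_on[OF holo]])
    show "continuous_on {0<..} (\<lambda>r. Complex (ln r) s)"
      unfolding Complex_eq by (intro continuous_intros) auto
  qed (use d that in auto)
  have cont_H: "continuous_on {0<..} H"
    using continuous_on_cong[OF refl, of "{0<..}" H "\<lambda>r. - Im (G (Complex (ln r) pi)) / pi"] H
    by (auto intro!: continuous_intros cont_G)
  have cont: "continuous_on {0<..} (\<lambda>r. of_real (H r) / (q + of_real r))" if "q \<notin> \<real>\<^sub>\<le>\<^sub>0" for q :: complex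
    by (intro continuous_intros cont_H) (use that not_nonpos_add_of_real_ne_0 in auto)
  have A_int: "set_integrable lborel (A n) g" if "continuous_on {0<..} g" for n and g :: "real \<Rightarrow> 'b :: euclidean_space"
    unfolding A_def by (rule borel_integrable_atLeastAtMost')
      (rule continuous_on_subset[OF that], use A_pos in \<open>auto simp: A_def\<close>)
  have lim: "(\<lambda>n. LBINT r:A n. of_real (H r) / (q + of_real r)) \<longlonglongrightarrow> G (Ln q)" if q: "q \<notin> \<real>\<^sub>\<le>\<^sub>0" for q
  proof -
    let ?g = "\<lambda>s r. G (Complex (ln r) s) / (q + of_real r)"
    have g_int: "?g s integrable_on A n" if "\<bar>s\<bar> = pi" for s n
      by (rule set_borel_integral_eq_integral(1)[OF A_int])
         (intro continuous_intros cont_G that, use q not_nonpos_add_of_real_ne_0 in auto)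
    have "integral (A n) (?g (- pi)) - integral (A n) (?g pi)
        = 2 * pi * \<i> * (LBINT r:A n. of_real (H r) / (q + of_real r))" for n
    proof -
      have "integral (A n) (?g (- pi)) - integral (A n) (?g pi) = integral (A n) (\<lambda>r. ?g (- pi) r - ?g pi r)"
        by (rule integral_diff[symmetric]) (use g_int in auto)
      also have "\<dots> = integral (A n) (\<lambda>r. 2 * pi * \<i> * (of_real (H r) / (q + of_real r)))"
      proof (rule integral_cong)
        fix r assume "r \<in> A n"
        then have r: "r > 0" by (rule A_pos)
        have "G (Complex (ln r) (- pi)) = cnj (G (Complex (ln r) pi))"
          using sym[of "Complex (ln r) pi"] d by (simp add: complex_cnj)
        then have "G (Complex (ln r) (- pi)) - G (Complex (ln r) pi) = 2 * pi * \<i> * of_real (H r)"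
          using H[OF r] by (simp add: complex_eq_iff)
        then show "?g (- pi) r - ?g pi r = 2 * pi * \<i> * (of_real (H r) / (q + of_real r))"
          by (simp add: diff_divide_distrib[symmetric])
      qed
      also have "\<dots> = 2 * pi * \<i> * integral (A n) (\<lambda>r. of_real (H r) / (q + of_real r))"
        by (rule integral_mult_right)
      also have "integral (A n) (\<lambda>r. of_real (H r) / (q + of_real r)) = (LBINT r:A n. of_real (H r) / (q + of_real r))"
        by (rule set_borel_integral_eq_integral(2)[OF A_int[OF cont[OF q]], symmetric])
      finally show ?thesis .
    qed
    then have "(\<lambda>n. 2 * pi * \<i> * (LBINT r:A n. of_real (H r) / (q + of_real r))) \<longlonglongrightarrow> 2 * pi * \<i> * G (Ln q)"
      using rectangle_residue_limit[OF d holo top bot q] by (simp add: A_def)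
    then show ?thesis by (subst (asm) tendsto_mult_left_iff) auto
  qed
  \<comment> \<open>Since H is nonnegative, the limit at p = 1 already forces integrability; other p follow by comparison.\<close>
  have "set_integrable lborel (\<Union>n. A n) (\<lambda>r. H r / (1 + r))"
  proof (rule pos_integrable_to_top)
    show "set_integrable lborel (A n) (\<lambda>r. H r / (1 + r))" for n
      by (intro A_int continuous_intros cont_H) auto
    have "(LBINT r:A n. of_real (H r) / (1 + of_real r)) = complex_of_real (LBINT r:A n. H r / (1 + r))" for n
      by (subst set_integral_complex_of_real[symmetric]) simp
    then show "(\<lambda>n. LBINT r:A n. H r / (1 + r)) \<longlonglongrightarrow> Re (G (Ln 1))"
      using tendsto_Re[OF lim[of 1]] by simp
    show "0 \<le> H r / (1 + r)" if "r \<in> A n" for r n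
      using A_pos[OF that] nonneg by (simp add: less_imp_le)
  qed (use A_mono in \<open>auto simp: A_def\<close>)
  then have int1: "set_integrable lborel {0<..} (\<lambda>r. H r / (1 + r))" by (simp only: A_UN)
  obtain C where C: "C > 0" "\<And>r. r \<ge> 0 \<Longrightarrow> 1 / cmod (p + of_real r) \<le> C / (1 + r)"
    using inverse_norm_add_of_real_le[OF p] by blast
  show int: "set_integrable lborel {0<..} (\<lambda>r. of_real (H r) / (p + of_real r))"
  proof (rule set_integrable_bound)
    show "set_integrable lborel {0<..} (\<lambda>r. C * (H r / (1 + r)))"
      by (intro set_integrable_mult_right int1)
    show "set_borel_measurable lborel {0<..} (\<lambda>r. of_real (H r) / (p + of_real r))"
      using set_measurable_continuous_on[OF _ cont[OF p]] by (simp add: set_borel_measurable_def)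
    have "norm (of_real (H r) / (p + of_real r)) \<le> norm (C * (H r / (1 + r)))" if "r > 0" for r
      using mult_left_mono[OF C(2)[of r] nonneg[OF that]] nonneg[OF that] C(1) that
      by (simp add: norm_divide mult.commute abs_mult)
    then show "AE r in lborel. r \<in> {0<..} \<longrightarrow> norm (of_real (H r) / (p + of_real r)) \<le> norm (C * (H r / (1 + r)))"
      by auto
  qed
  have "(\<lambda>n. LBINT r:A n. of_real (H r) / (p + of_real r)) \<longlonglongrightarrow> (LBINT r:(\<Union>n. A n). of_real (H r) / (p + of_real r))"
    by (rule set_integral_cont_up) (use A_mono int in \<open>simp_all only: A_UN, auto simp: A_def\<close>)
  then show "(LBINT r:{0<..}. of_real (H r) / (p + of_real r)) = G (Ln p)"
    using LIMSEQ_unique lim[OF p] by (simp add: A_UN)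
qed

section \<open>The Cole-Cole model\<close>

text \<open>Solving for \<open>w\<close> when the ratio equals \<open>- s\<close> with
  \<open>s \<ge> 0\<close> gives \<open>w = - (1 + s) / (1 + s * a)\<close>, a point of the cut; a
  vanishing denominator would give \<open>w = - 1 / a\<close>. This keeps the argument of
  \<open>csqrt\<close> in its domain of holomorphy.\<close>

lemma cole_cole_ratio_not_nonpos:
  assumes a: "a > 0" and w: "w \<notin> \<real>\<^sub>\<le>\<^sub>0"
  shows "1 + complex_of_real a * w \<noteq> 0" and "(1 + w) / (1 + of_real a * w) \<notin> \<real>\<^sub>\<le>\<^sub>0"
proof -
  have *: "w \<noteq> of_real (- s)" if "s \<ge> 0" for s
    using w that by (auto simp: complex_nonpos_Reals_iff)
  show ne: "1 + complex_of_real a * w \<noteq> 0"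
  proof
    assume "1 + complex_of_real a * w = 0"
    then have "w = of_real (- (1 / a))"
      using a by (simp add: field_simps eq_neg_iff_add_eq_0)
    with *[of "1 / a"] a show False by simp
  qed
  show "(1 + w) / (1 + of_real a * w) \<notin> \<real>\<^sub>\<le>\<^sub>0"
  proof
    assume "(1 + w) / (1 + of_real a * w) \<in> \<real>\<^sub>\<le>\<^sub>0"
    then obtain s where s: "s \<ge> 0" "(1 + w) / (1 + of_real a * w) = of_real (- s)"
      by (metis nonpos_Reals_cases neg_0_le_iff_le minus_minus)
    have pos: "1 + s * a > 0" using s a by (simp add: add_pos_nonneg)
    have "1 + w = of_real (- s) * (1 + of_real a * w)" using s(2) ne by (simp add: field_simps)
    then have "w * of_real (1 + s * a) = of_real (- (1 + s))" by (simp add: algebra_simps eq_neg_iff_add_eq_0)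
    then have "w = of_real (- (1 + s)) / of_real (1 + s * a)"
      using pos by (metis nonzero_mult_div_cancel_right of_real_eq_0_iff less_irrefl)
    then have "w = of_real (- ((1 + s) / (1 + s * a)))"
      by (simp only: of_real_divide minus_divide_left)
    with *[of "(1 + s) / (1 + s * a)"] pos s(1) show False by simp
  qed
qed

text \<open>A nonpositive value would be negative, so it would have a logarithm with imaginary part
  \<open>pi\<close>. Two logarithms whose imaginary parts differ by less than \<open>2 * pi\<close>
  coincide, which contradicts the bound on \<open>Im u\<close>.\<close>

lemma exp_not_nonpos:
  assumes "\<bar>Im u\<bar> < pi" and "t > 0"
  shows "complex_of_real t * exp u \<notin> \<real>\<^sub>\<le>\<^sub>0"
proof
  assume "complex_of_real t * exp u \<in> \<real>\<^sub>\<le>\<^sub>0"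
  then obtain s where s: "s \<le> 0" "complex_of_real t * exp u = of_real s"
    by (auto elim!: nonpos_Reals_cases)
  have "s \<noteq> 0" using s(2) assms(2) by auto
  with s(1) have s0: "s < 0" by simp
  have "exp u = of_real (s / t)" using s(2) assms(2) by (simp add: field_simps)
  also have "\<dots> = exp (Complex (ln (- s / t)) pi)"
    using s0 assms(2) by (simp add: exp_eq_polar divide_neg_pos complex_eq_iff)
  finally have "u = Complex (ln (- s / t)) pi"
    by (rule exp_complex_eqI[rotated]) (use assms(1) in auto)
  then show False using assms(1) by simp
qed

section \<open>The remainder in the coordinate z = Ln p\<close>

text \<open>This is the power of \<tau> p as an entire function of \<open>z = Ln p\<close>; unlike
  \<open>powr\<close> it has no jump at \<open>Im z = pi\<close>.\<close>

definition cole_cole_power :: "real \<Rightarrow> real \<Rightarrow> complex \<Rightarrow> complex"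
  where "cole_cole_power \<tau> \<alpha> z = of_real (\<tau> powr \<alpha>) * exp (of_real \<alpha> * z)"

text \<open>At \<open>z = Ln p\<close> this is \<open>c\<^sub>0 * \<beta>(p) / p\<close>, where
  \<beta> is the part of the wave number left after removing its linear term.\<close>

definition cole_cole_remainder :: "real \<Rightarrow> real \<Rightarrow> real \<Rightarrow> complex \<Rightarrow> complex"
  where "cole_cole_remainder \<tau> a \<alpha> z =
    csqrt ((1 + cole_cole_power \<tau> \<alpha> z) / (1 + of_real a * cole_cole_power \<tau> \<alpha> z)) - of_real (a powr (- 1 / 2))"

text \<open>A positive factor \<tau> does not change the argument, so
  \<open>Ln (\<tau> * p) = ln \<tau> + Ln p\<close> without a branch correction.\<close>

lemma cole_cole_power_Ln:
  assumes "\<tau> > 0" "p \<noteq> 0"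
  shows "cole_cole_power \<tau> \<alpha> (Ln p) = (of_real \<tau> * p) powr of_real \<alpha>"
  using assms by (simp add: cole_cole_power_def powr_def Ln_times_of_real exp_add distrib_left
      flip: exp_of_real Ln_of_real)

text \<open>Scaling by \<alpha> maps this strip onto the strip of half-width \<open>pi\<close>. For
  \<open>\<alpha> < 1\<close> the strip contains the lines \<open>Im z = pi\<close> and
  \<open>Im z = - pi\<close> in its interior.\<close>

lemma cole_cole_power_not_nonpos:
  assumes "\<tau> > 0" "\<alpha> > 0" "\<bar>Im z\<bar> < pi / \<alpha>"
  shows "cole_cole_power \<tau> \<alpha> z \<notin> \<real>\<^sub>\<le>\<^sub>0"
  unfolding cole_cole_power_def
  by (rule exp_not_nonpos) (use assms in \<open>auto simp: abs_mult field_simps\<close>)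

lemma cole_cole_remainder_holomorphic:
  assumes "\<tau> > 0" "\<alpha> > 0" "a > 0"
  shows "cole_cole_remainder \<tau> a \<alpha> holomorphic_on {z. \<bar>Im z\<bar> < pi / \<alpha>}"
proof -
  have w: "cole_cole_power \<tau> \<alpha> holomorphic_on {z. \<bar>Im z\<bar> < pi / \<alpha>}"
    unfolding cole_cole_power_def by (intro holomorphic_intros)
  show ?thesis
    unfolding cole_cole_remainder_def
    by (intro holomorphic_intros w)
       (use cole_cole_ratio_not_nonpos[OF assms(3) cole_cole_power_not_nonpos[OF assms(1,2)]] in auto)
qed

lemma cole_cole_remainder_cnj:
  assumes "\<tau> > 0" "\<alpha> > 0" "a > 0" "\<bar>Im z\<bar> < pi / \<alpha>"
  shows "cole_cole_remainder \<tau> a \<alpha> (cnj z) = cnj (cole_cole_remainder \<tau> a \<alpha> z)"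
proof -
  have w: "cole_cole_power \<tau> \<alpha> (cnj z) = cnj (cole_cole_power \<tau> \<alpha> z)"
    by (simp add: cole_cole_power_def exp_cnj)
  show ?thesis
    using cnj_csqrt[OF cole_cole_ratio_not_nonpos(2)[OF assms(3) cole_cole_power_not_nonpos[OF assms(1,2,4)]]]
    by (simp add: cole_cole_remainder_def w)
qed

lemma csqrt_inverse_of_real:
  assumes "a > 0"
  shows "csqrt (1 / of_real a) = of_real (a powr (- 1 / 2))"
proof -
  have "csqrt (1 / of_real a) = of_real (sqrt (1 / a))"
    using csqrt_of_real[of "1 / a"] assms by simp
  also have "sqrt (1 / a) = a powr (- 1 / 2)"
    using powr_minus[of a "1 / 2"] powr_half_sqrt[of a] assms by (simp add: real_sqrt_divide inverse_eq_divide)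
  finally show ?thesis .
qed

text \<open>The modulus of the power depends on \<open>Re z\<close> alone, so it grows uniformly in
  \<open>Im z\<close>. After division by the power the ratio tends to \<open>1 / a\<close>, whose
  root is the subtracted constant.\<close>

lemma cole_cole_remainder_top:
  assumes "\<tau> > 0" "\<alpha> > 0" "a > 0"
  shows "(cole_cole_remainder \<tau> a \<alpha> \<longlongrightarrow> 0) (filtercomap Re at_top)"
proof -
  let ?F = "filtercomap Re at_top"
  have "filterlim (cole_cole_power \<tau> \<alpha>) at_infinity ?F"
  proof (rule filterlim_norm_at_top_imp_at_infinity)
    have "filterlim (\<lambda>x. \<tau> powr \<alpha> * exp (\<alpha> * x)) at_top at_top"
      using assms by real_asymp
    then have "filterlim (\<lambda>z. \<tau> powr \<alpha> * exp (\<alpha> * Re z)) at_top ?F"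
      by (rule filterlim_compose[OF _ filterlim_filtercomap])
    then show "filterlim (\<lambda>z. norm (cole_cole_power \<tau> \<alpha> z)) at_top ?F"
      by (simp add: cole_cole_power_def norm_mult norm_exp_eq_Re)
  qed
  then have inv: "((\<lambda>z. inverse (cole_cole_power \<tau> \<alpha> z)) \<longlongrightarrow> 0) ?F"
    by (rule filterlim_compose[OF tendsto_inverse_0])
  have "((\<lambda>z. csqrt ((inverse (cole_cole_power \<tau> \<alpha> z) + 1) / (inverse (cole_cole_power \<tau> \<alpha> z) + of_real a)))
      \<longlongrightarrow> csqrt ((0 + 1) / (0 + of_real a))) ?F"
  proof (rule isCont_tendsto_compose[OF continuous_at_csqrt])
    show "(0 + 1) / (0 + complex_of_real a) \<notin> \<real>\<^sub>\<le>\<^sub>0"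
      using assms by (simp add: complex_nonpos_Reals_iff Re_divide_of_real)
    show "((\<lambda>z. (inverse (cole_cole_power \<tau> \<alpha> z) + 1) / (inverse (cole_cole_power \<tau> \<alpha> z) + of_real a))
        \<longlongrightarrow> (0 + 1) / (0 + of_real a)) ?F"
      by (intro tendsto_intros inv) (use assms in auto)
  qed
  moreover have "(inverse (cole_cole_power \<tau> \<alpha> z) + 1) / (inverse (cole_cole_power \<tau> \<alpha> z) + of_real a)
     = (1 + cole_cole_power \<tau> \<alpha> z) / (1 + of_real a * cole_cole_power \<tau> \<alpha> z)" for z
  proof -
    have "cole_cole_power \<tau> \<alpha> z \<noteq> 0" using assms by (simp add: cole_cole_power_def)
    then show ?thesis
      using mult_divide_mult_cancel_left[of "cole_cole_power \<tau> \<alpha> z" "inverse (cole_cole_power \<tau> \<alpha> z) + 1"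
          "inverse (cole_cole_power \<tau> \<alpha> z) + of_real a"]
      by (simp add: distrib_left mult.commute)
  qed
  ultimately show ?thesis
    unfolding cole_cole_remainder_def
    using csqrt_inverse_of_real[OF assms(3)] by (simp add: tendsto_diff LIM_zero)
qed

lemma cole_cole_remainder_bot:
  assumes "\<tau> > 0" "\<alpha> > 0" "a > 0"
  shows "(cole_cole_remainder \<tau> a \<alpha> \<longlongrightarrow> 1 - of_real (a powr (- 1 / 2))) (filtercomap Re at_bot)"
proof -
  let ?F = "filtercomap Re at_bot"
  have w: "(cole_cole_power \<tau> \<alpha> \<longlongrightarrow> 0) ?F"
  proof (rule tendsto_norm_zero_cancel)
    have "((\<lambda>x. \<tau> powr \<alpha> * exp (\<alpha> * x)) \<longlongrightarrow> 0) at_bot"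
      using assms by real_asymp
    then have "((\<lambda>z. \<tau> powr \<alpha> * exp (\<alpha> * Re z)) \<longlongrightarrow> 0) ?F"
      by (rule filterlim_compose[OF _ filterlim_filtercomap])
    then show "((\<lambda>z. norm (cole_cole_power \<tau> \<alpha> z)) \<longlongrightarrow> 0) ?F"
      by (simp add: cole_cole_power_def norm_mult norm_exp_eq_Re)
  qed
  have "((\<lambda>z. csqrt ((1 + cole_cole_power \<tau> \<alpha> z) / (1 + of_real a * cole_cole_power \<tau> \<alpha> z)))
      \<longlongrightarrow> csqrt ((1 + 0) / (1 + of_real a * 0))) ?F"
    by (intro isCont_tendsto_compose[OF continuous_at_csqrt] tendsto_intros w) auto
  then have "((\<lambda>z. csqrt ((1 + cole_cole_power \<tau> \<alpha> z) / (1 + of_real a * cole_cole_power \<tau> \<alpha> z)))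
      \<longlongrightarrow> 1) ?F"
    by simp
  then show ?thesis
    unfolding cole_cole_remainder_def by (intro tendsto_intros)
qed

section \<open>The density on the upper side of the cut\<close>

text \<open>Multiplying by the conjugate denominator writes the ratio as
  \<open>(R + \<i> * J) / Z\<^sup>2\<close>. The nested roots in \<open>cole_cole_h\<close> then
  come from the explicit formula for the imaginary part of a principal square root.\<close>

lemma cole_cole_h_eq_Im:
  assumes "\<tau> > 0" "0 < \<alpha>" "\<alpha> < 1" "a > 1" "r > 0" "c\<^sub>0 > 0"
  shows "c\<^sub>0 * cole_cole_h c\<^sub>0 \<tau> a \<alpha> r = - Im (cole_cole_remainder \<tau> a \<alpha> (Complex (ln r) pi)) / pi"
    and "cole_cole_h c\<^sub>0 \<tau> a \<alpha> r \<ge> 0"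
proof -
  define x where "x = (\<tau> * r) powr \<alpha>"
  define w where "w = cole_cole_power \<tau> \<alpha> (Complex (ln r) pi)"
  define R J Z where "R = cole_cole_R \<tau> a \<alpha> r" and "J = cole_cole_J \<tau> a \<alpha> r" and "Z = cole_cole_Z \<tau> a \<alpha> r"
  define q where "q = (1 + w) / (1 + of_real a * w)"
  have x: "x > 0" using assms by (simp add: x_def)
  have x2: "(\<tau> * r) powr (2 * \<alpha>) = x\<^sup>2"
    by (simp add: x_def powr_powr powr_numeral[symmetric] mult.commute del: powr_numeral)
  have "w = of_real x * cis (\<alpha> * pi)"
    using assms by (simp add: w_def x_def cole_cole_power_def exp_eq_polar powr_mult powr_def[of r] exp_of_real)
  then have Re_w: "Re w = x * cos (pi * \<alpha>)" and Im_w: "Im w = x * sin (pi * \<alpha>)"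
    by (simp_all add: mult.commute)
  have trig: "(cos (pi * \<alpha>))\<^sup>2 + (sin (pi * \<alpha>))\<^sup>2 = 1" by simp
  have w_ok: "w \<notin> \<real>\<^sub>\<le>\<^sub>0"
    unfolding w_def by (rule cole_cole_power_not_nonpos) (use assms in \<open>auto simp: field_simps\<close>)
  have den: "1 + of_real a * w \<noteq> 0"
    using cole_cole_ratio_not_nonpos(1)[OF _ w_ok, of a] assms by simp
  have norm_den: "(cmod (1 + of_real a * w))\<^sup>2 = 1 + a\<^sup>2 * x\<^sup>2 + 2 * a * cos (pi * \<alpha>) * x"
  proof -
    have "(cmod (1 + of_real a * w))\<^sup>2 = (1 + a * (x * cos (pi * \<alpha>)))\<^sup>2 + (a * (x * sin (pi * \<alpha>)))\<^sup>2"
      by (simp add: cmod_power2 Re_w Im_w)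
    also have "\<dots> = 1 + 2 * a * cos (pi * \<alpha>) * x + a\<^sup>2 * x\<^sup>2 * ((cos (pi * \<alpha>))\<^sup>2 + (sin (pi * \<alpha>))\<^sup>2)"
      by algebra
    finally show ?thesis by (simp only: trig)
  qed
  then have Z: "Z = cmod (1 + of_real a * w)"
    unfolding Z_def cole_cole_Z_def x2 x_def[symmetric] norm_den[symmetric] by simp
  have Z_pos: "Z > 0" using den by (simp add: Z)
  have prod: "(1 + w) * cnj (1 + of_real a * w) = Complex R J"
  proof (rule complex_eqI)
    have "Re ((1 + w) * cnj (1 + of_real a * w)) =
       1 + (a + 1) * (x * cos (pi * \<alpha>)) + a * x\<^sup>2 * ((cos (pi * \<alpha>))\<^sup>2 + (sin (pi * \<alpha>))\<^sup>2)"
      by (simp add: Re_w Im_w del: sin_cos_squared_add sin_cos_squared_add2) algebra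
    also have "\<dots> = R"
      unfolding trig by (simp add: R_def cole_cole_R_def x2 x_def[symmetric])
    finally show "Re ((1 + w) * cnj (1 + of_real a * w)) = Re (Complex R J)"
      by (simp only: complex.sel)
    show "Im ((1 + w) * cnj (1 + of_real a * w)) = Im (Complex R J)"
      by (simp add: Re_w Im_w J_def cole_cole_J_def x_def[symmetric] algebra_simps)
  qed
  have q: "q = Complex R J / of_real (Z\<^sup>2)"
    unfolding q_def Z complex_div_cnj[of "1 + w"] prod by simp
  have cmod_q: "cmod q = sqrt (R\<^sup>2 + J\<^sup>2) / Z\<^sup>2"
    by (simp only: q norm_divide complex_norm norm_of_real) simp
  have Re_q: "Re q = R / Z\<^sup>2" and Im_q: "Im q = J / Z\<^sup>2" by (simp_all add: q del: of_real_power)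
  \<comment> \<open>The sign of \<open>J\<close> selects the negative imaginary part of the
    principal root, which is what makes the density nonnegative.\<close>
  have "sin (pi * \<alpha>) > 0" using assms by (intro sin_gt_zero) auto
  then have "J < 0"
    using assms x by (simp add: J_def cole_cole_J_def x_def[symmetric] mult_neg_pos)
  then have "Im q < 0" using Z_pos by (simp add: Im_q divide_neg_pos)
  then have "Im (csqrt q) = - sqrt ((cmod q - Re q) / 2)" by simp
  also have "(cmod q - Re q) / 2 = (sqrt (R\<^sup>2 + J\<^sup>2) - R) / (2 * Z\<^sup>2)"
    by (simp add: cmod_q Re_q diff_divide_distrib[symmetric] field_simps)
  also have "sqrt \<dots> = sqrt (sqrt (R\<^sup>2 + J\<^sup>2) - R) / (sqrt 2 * Z)"
    using Z_pos by (simp add: real_sqrt_divide real_sqrt_mult)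
  finally have "Im (csqrt q) = - (sqrt (sqrt (R\<^sup>2 + J\<^sup>2) - R) / (sqrt 2 * Z))" .
  then show "c\<^sub>0 * cole_cole_h c\<^sub>0 \<tau> a \<alpha> r = - Im (cole_cole_remainder \<tau> a \<alpha> (Complex (ln r) pi)) / pi"
    using assms
    by (simp add: cole_cole_remainder_def w_def[symmetric] q_def[symmetric] cole_cole_h_def
        R_def[symmetric] J_def[symmetric] Z_def[symmetric] del: csqrt.simps)
  have "R \<le> sqrt (R\<^sup>2 + J\<^sup>2)" by simp
  then show "cole_cole_h c\<^sub>0 \<tau> a \<alpha> r \<ge> 0"
    using assms Z_pos
    by (simp add: cole_cole_h_def R_def[symmetric] J_def[symmetric] Z_def[symmetric])
qed

section \<open>Wave number, attenuation and dispersion\<close>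

lemma set_integral_Re_Im:
  fixes f :: "'a \<Rightarrow> complex"
  assumes "set_integrable M A f"
  shows "set_integrable M A (\<lambda>x. Re (f x))" "(LINT x:A|M. Re (f x)) = Re (LINT x:A|M. f x)"
    and "set_integrable M A (\<lambda>x. Im (f x))" "(LINT x:A|M. Im (f x)) = Im (LINT x:A|M. f x)"
  using assms integral_Re[of M "\<lambda>x. indicator A x *\<^sub>R f x"] integral_Im[of M "\<lambda>x. indicator A x *\<^sub>R f x"]
    integrable_Re[of M "\<lambda>x. indicator A x *\<^sub>R f x"] integrable_Im[of M "\<lambda>x. indicator A x *\<^sub>R f x"]
  by (simp_all add: set_integrable_def set_lebesgue_integral_def)

text \<open>A positive factor has argument 0, so the sum of the arguments stays in the principal
  range, where \<open>csqrt\<close> is multiplicative.\<close>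

lemma csqrt_of_real_mult:
  assumes "r > 0"
  shows "csqrt (of_real r * z) = of_real (sqrt r) * csqrt z"
proof -
  have "Arg (of_real r) = 0" using assms by (simp add: Arg_of_real)
  then show ?thesis
    using csqrt_mult[of "of_real r" z] csqrt_of_real[of r] assms Arg_le_pi[of z] mpi_less_Arg[of z] by simp
qed

text \<open>Here \<open>p\<close> times the transform is \<open>Ginf / q\<close>, with
  \<open>q\<close> the ratio under the root in \<open>cole_cole_kappa\<close>. Since
  \<open>q\<close> avoids the cut, the principal root of the quotient splits without a sign
  change.\<close>

lemma wave_number_cole_cole:
  assumes "\<rho> > 0" "Ginf > 0" "\<tau> > 0" "a > 0" "0 < \<alpha>" "\<alpha> < 1" "p \<notin> \<real>\<^sub>\<le>\<^sub>0"
  shows "wave_number \<rho> (cole_cole_transform Ginf \<tau> a \<alpha>) p = cole_cole_kappa (sqrt (Ginf / \<rho>)) \<tau> a \<alpha> p"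
proof -
  define w where "w = (of_real \<tau> * p) powr of_real \<alpha>"
  define q where "q = (1 + w) / (1 + of_real a * w)"
  have p0: "p \<noteq> 0" using assms by auto
  have "\<bar>Im (Ln p)\<bar> < pi"
    using assms(7) mpi_less_Im_Ln[OF p0] Im_Ln_less_pi[OF assms(7)] by (simp add: abs_less_iff)
  also have "pi < pi / \<alpha>" using assms by (simp add: field_simps)
  finally have w: "w \<notin> \<real>\<^sub>\<le>\<^sub>0"
    using cole_cole_power_not_nonpos[of \<tau> \<alpha> "Ln p"] cole_cole_power_Ln[of \<tau> p \<alpha>] p0 assms by (simp add: w_def)
  have q: "q \<notin> \<real>\<^sub>\<le>\<^sub>0" unfolding q_def by (rule cole_cole_ratio_not_nonpos(2)[OF assms(4) w])
  have "p * cole_cole_transform Ginf \<tau> a \<alpha> p = of_real Ginf * inverse q"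
    using p0 by (simp add: cole_cole_transform_def w_def[symmetric] q_def)
  then have "csqrt (p * cole_cole_transform Ginf \<tau> a \<alpha> p) = of_real (sqrt Ginf) * inverse (csqrt q)"
    using csqrt_of_real_mult[OF assms(2)] csqrt_inverse[OF q] by simp
  then show ?thesis
    by (simp add: wave_number_def cole_cole_kappa_def w_def[symmetric] q_def[symmetric] real_sqrt_divide del: csqrt.simps)
       (simp add: divide_inverse)
qed

text \<open>The conjunct about \<open>B\<close> certifies that \<open>Lim\<close> in
  \<open>wavefront_slope\<close> is an actual limit, and the integrability conjuncts rule out the
  default value 0 of the Lebesgue integral. Attenuation and dispersion refer to
  \<open>\<kappa>\<^sub>m\<close>, the wave number built from the relaxation modulus.\<close>

theorem mainTheorem5:
  fixes \<rho> Ginf \<tau> a \<alpha> c\<^sub>0 :: real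
    and \<kappa> \<kappa>\<^sub>m :: "complex \<Rightarrow> complex" and h :: "real \<Rightarrow> real"
  assumes "\<rho> > 0" "Ginf > 0" "\<tau> > 0" "a > 1" "0 < \<alpha>" "\<alpha> < 1"
    and "c\<^sub>0 = sqrt (Ginf / \<rho>)"
    and "\<kappa> = cole_cole_kappa c\<^sub>0 \<tau> a \<alpha>"
    and "\<kappa>\<^sub>m = wave_number \<rho> (cole_cole_transform Ginf \<tau> a \<alpha>)"
    and "h = cole_cole_h c\<^sub>0 \<tau> a \<alpha>"
  shows "(\<forall>p. p \<notin> \<real>\<^sub>\<le>\<^sub>0 \<longrightarrow>
            \<kappa>\<^sub>m p = \<kappa> p \<and>
            set_integrable lborel {0<..} (\<lambda>r. of_real (h r) / (p + of_real r)) \<and>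
            \<kappa> p = of_real (a powr (- 1 / 2) / c\<^sub>0) * p
                  + p * (LBINT r:{0<..}. of_real (h r) / (p + of_real r)))
       \<and> (\<exists>B. ((\<lambda>x::real. \<kappa>\<^sub>m (of_real x) / of_real x) \<longlongrightarrow> B) at_top)
       \<and> (\<forall>\<omega>. \<omega> \<noteq> 0 \<longrightarrow>
            set_integrable lborel {0<..} (\<lambda>r. h r / (r\<^sup>2 + \<omega>\<^sup>2)) \<and>
            attenuation \<kappa>\<^sub>m \<omega> = \<omega>\<^sup>2 * (LBINT r:{0<..}. h r / (r\<^sup>2 + \<omega>\<^sup>2)) \<and>
            set_integrable lborel {0<..} (\<lambda>r. r * h r / (r\<^sup>2 + \<omega>\<^sup>2)) \<and>
            dispersion \<kappa>\<^sub>m \<omega> = \<omega> * (LBINT r:{0<..}. r * h r / (r\<^sup>2 + \<omega>\<^sup>2)))"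
proof -
  define G where "G = cole_cole_remainder \<tau> a \<alpha>"
  define B where "B = complex_of_real (a powr (- 1 / 2) / c\<^sub>0)"
  have c0: "c\<^sub>0 > 0" using assms by simp
  have a: "a > 0" using assms by simp
  have d: "pi / \<alpha> > pi" using assms by (simp add: field_simps)
  have G_props: "G holomorphic_on {z. \<bar>Im z\<bar> < pi / \<alpha>}" "(G \<longlongrightarrow> 0) (filtercomap Re at_top)"
    "(G \<longlongrightarrow> 1 - of_real (a powr (- 1 / 2))) (filtercomap Re at_bot)"
    "\<And>z. \<bar>Im z\<bar> < pi / \<alpha> \<Longrightarrow> G (cnj z) = cnj (G z)"
    unfolding G_def
    by (fact cole_cole_remainder_holomorphic[OF assms(3,5) a] cole_cole_remainder_top[OF assms(3,5) a]
        cole_cole_remainder_bot[OF assms(3,5) a] cole_cole_remainder_cnj[OF assms(3,5) a])+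
  have H: "c\<^sub>0 * h r = - Im (G (Complex (ln r) pi)) / pi" "c\<^sub>0 * h r \<ge> 0" if "r > 0" for r
    using cole_cole_h_eq_Im[OF assms(3,5,6,4) that c0] mult_nonneg_nonneg[OF less_imp_le[OF c0]]
    unfolding assms(10) G_def by blast+
  define I :: "complex \<Rightarrow> complex" where "I = (\<lambda>p. LBINT r:{0<..}. of_real (h r) / (p + of_real r))"
  have rep: "set_integrable lborel {0<..} (\<lambda>r. of_real (h r) / (p + of_real r)) \<and> I p = G (Ln p) / of_real c\<^sub>0"
    if p: "p \<notin> \<real>\<^sub>\<le>\<^sub>0" for p
  proof -
    have *: "set_integrable lborel {0<..} (\<lambda>r. of_real (c\<^sub>0 * h r) / (p + of_real r))"
      "(LBINT r:{0<..}. of_real (c\<^sub>0 * h r) / (p + of_real r)) = G (Ln p)"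
      using stieltjes_representation[OF d G_props H p] by blast+
    \<comment> \<open>The Stieltjes representation has density \<open>c\<^sub>0 * h r\<close>; the
      constant is divided out here.\<close>
    have eq: "of_real (h r) / (p + of_real r) = (1 / of_real c\<^sub>0) * (of_real (c\<^sub>0 * h r) / (p + of_real r))" for r
      using c0 by simp
    show ?thesis
      unfolding I_def eq set_integral_mult_right *(2)
      using set_integrable_mult_right[OF *(1), of "1 / of_real c\<^sub>0"] by simp
  qed
  have kappa: "\<kappa>\<^sub>m p = \<kappa> p" "\<kappa> p = B * p + p * I p" if p: "p \<notin> \<real>\<^sub>\<le>\<^sub>0" for p
  proof -
    show "\<kappa>\<^sub>m p = \<kappa> p"
      using wave_number_cole_cole[OF assms(1-3) a assms(5,6) p] assms by simp
    have "p \<noteq> 0" using p by auto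
    then have "\<kappa> p = p / of_real c\<^sub>0 * (G (Ln p) + of_real (a powr (- 1 / 2)))"
      using assms by (simp add: cole_cole_kappa_def G_def cole_cole_remainder_def cole_cole_power_Ln del: csqrt.simps)
    also have "\<dots> = B * p + p * I p"
      using rep[OF p] by (simp add: B_def algebra_simps)
    finally show "\<kappa> p = B * p + p * I p" .
  qed
  have lim: "((\<lambda>x::real. \<kappa>\<^sub>m (of_real x) / of_real x) \<longlongrightarrow> B) at_top"
  proof -
    \<comment> \<open>For \<open>x > 0\<close>, \<open>Ln x\<close> is the real number
      \<open>ln x\<close>, so the decay of \<open>G\<close> at the right end of the strip
      applies.\<close>
    have "filterlim (\<lambda>x::real. Ln (of_real x)) (filtercomap Re at_top) at_top"
      unfolding filterlim_filtercomap_iff o_def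
      by (rule filterlim_mono_eventually[OF ln_at_top]) (auto intro: eventually_mono[OF eventually_gt_at_top[of 0]] simp: Ln_of_real)
    from filterlim_compose[OF cole_cole_remainder_top[OF assms(3,5) a] this]
    have "((\<lambda>x::real. G (Ln (of_real x))) \<longlongrightarrow> 0) at_top" by (simp add: G_def)
    then have "((\<lambda>x::real. B + G (Ln (of_real x)) / of_real c\<^sub>0) \<longlongrightarrow> B + 0 / of_real c\<^sub>0) at_top"
      using c0 by (intro tendsto_intros) auto
    moreover have "\<forall>\<^sub>F x::real in at_top. B + G (Ln (of_real x)) / of_real c\<^sub>0 = \<kappa>\<^sub>m (of_real x) / of_real x"
      using eventually_gt_at_top[of 0]
    proof eventually_elim
      case (elim x)
      then have "complex_of_real x \<notin> \<real>\<^sub>\<le>\<^sub>0" by simp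
      with elim show ?case using kappa[of "of_real x"] rep[of "of_real x"] by (simp add: field_simps)
    qed
    ultimately show ?thesis by (simp add: tendsto_cong)
  qed
  have slope: "wavefront_slope \<kappa>\<^sub>m = B"
    unfolding wavefront_slope_def by (rule tendsto_Lim[OF _ lim]) simp
  have freq: "set_integrable lborel {0<..} (\<lambda>r. h r / (r\<^sup>2 + \<omega>\<^sup>2)) \<and>
            attenuation \<kappa>\<^sub>m \<omega> = \<omega>\<^sup>2 * (LBINT r:{0<..}. h r / (r\<^sup>2 + \<omega>\<^sup>2)) \<and>
            set_integrable lborel {0<..} (\<lambda>r. r * h r / (r\<^sup>2 + \<omega>\<^sup>2)) \<and>
            dispersion \<kappa>\<^sub>m \<omega> = \<omega> * (LBINT r:{0<..}. r * h r / (r\<^sup>2 + \<omega>\<^sup>2))"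
    if \<omega>: "\<omega> \<noteq> 0" for \<omega>
  proof -
    define p where "p = - \<i> * complex_of_real \<omega>"
    have p: "p \<notin> \<real>\<^sub>\<le>\<^sub>0" using \<omega> by (simp add: p_def complex_nonpos_Reals_iff)
    have rem: "wave_number_remainder \<kappa>\<^sub>m p = p * I p"
      using kappa[OF p] by (simp add: wave_number_remainder_def slope)
    \<comment> \<open>With \<open>p = - \<i> * \<omega>\<close>, the kernel
      \<open>1 / (r - \<i> * \<omega>)\<close> equals
      \<open>(r + \<i> * \<omega>) / (r\<^sup>2 + \<omega>\<^sup>2)\<close>.\<close>
    have Re_f: "Re (of_real (h r) / (p + of_real r)) = r * h r / (r\<^sup>2 + \<omega>\<^sup>2)"
      and Im_f: "Im (of_real (h r) / (p + of_real r)) = \<omega> * (h r / (r\<^sup>2 + \<omega>\<^sup>2))" for r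
      by (simp_all add: p_def Re_divide Im_divide mult.commute)
    note int = set_integral_Re_Im[OF conjunct1[OF rep[OF p]], unfolded Re_f Im_f]
    have Im_I: "Im (I p) = \<omega> * (LBINT r:{0<..}. h r / (r\<^sup>2 + \<omega>\<^sup>2))"
      using int(4) by (simp only: set_integral_mult_right I_def)
    have Re_I: "Re (I p) = (LBINT r:{0<..}. r * h r / (r\<^sup>2 + \<omega>\<^sup>2))"
      using int(2) by (simp only: I_def)
    \<comment> \<open>The imaginary part carries a factor \<omega>, which is removed because it is
      nonzero.\<close>
    have "set_integrable lborel {0<..} (\<lambda>r. (1 / \<omega>) * (\<omega> * (h r / (r\<^sup>2 + \<omega>\<^sup>2))))"
      by (intro set_integrable_mult_right int(3))
    then have "set_integrable lborel {0<..} (\<lambda>r. h r / (r\<^sup>2 + \<omega>\<^sup>2))" using \<omega> by simp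
    \<comment> \<open>Multiplication by \<open>- \<i> * \<omega>\<close> exchanges real and
      imaginary parts, so the attenuation comes from \<open>Im (I p)\<close> and the dispersion from
      \<open>Re (I p)\<close>.\<close>
    moreover have "attenuation \<kappa>\<^sub>m \<omega> = \<omega> * Im (I p)" "dispersion \<kappa>\<^sub>m \<omega> = \<omega> * Re (I p)"
      using rem by (simp_all add: attenuation_def dispersion_def p_def)
    ultimately show ?thesis using int(1) by (simp add: Im_I Re_I power2_eq_square mult.assoc)
  qed
  show ?thesis
    using rep kappa lim freq unfolding B_def I_def by blast
qed

end
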